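(* Let $G$ be a finite simple graph with $n$ non-isolated vertices and matching number $\nu$. For $k\ge n-1$, the inequality $\varepsilon_k(G)\le k\nu$ holds except precisely when $k=n-1$ and $G^+\cong K_{2r+1}-F$, where $r\ge 1$, $F\subseteq E(K_{2r+1})$, and $|F|<r$. Moreover, if $k\ge n$, then equality $\varepsilon_k(G)=k\nu$ holds if and only if $k=n$ and $G^+\cong K_{2r+1}$ for some $r\ge 1$. For $k=n-1$, equality $\varepsilon_k(G)=k\nu$ holds if and only if $G^+$ is (up to isomorphism) one of the following graphs: (i) $K_{1,t}$ with $t\ge 1$, or $K_{2r}$ with $r\ge 2$; (ii) $K_{2r+1}-F$, where $r\ge 2$, $F\subseteq E(K_{2r+1})$, and $|F|=r$.
   Context: For a finite simple graph $G=(V,E)$, $L(G)=D(G)-A(G)$ is the Laplacian matrix ($D(G)$ the diagonal degree matrix, $A(G)$ the adjacency matrix) with eigenvalues $\lambda_1(L(G))\ge\cdots\ge\lambda_{|V|}(L(G))$, and for an integer $k\ge 0$, $\varepsilon_k(G)=\sum_{j=1}^{\min\{k,|V|\}}\lambda_j(L(G))-|E|$ (empty sum $=0$). The matching number $\nu=\nu(G)$ is the maximum size of a matching in $G$. $G^+$ denotes the subgraph of $G$ induced by the vertices of positive degree, so $n=|V(G^+)|$. For $F\subseteq E(K_m)$, $K_m-F$ is the graph obtained from the complete graph $K_m$ by deleting the edges in $F$; $K_{1,t}$ is the star with $t$ edges.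
   Formalization: In the clause for k ≥ n, the equality characterization is stated only for graphs with n ≥ 1 (at least one edge); for edgeless graphs n = ν = 0, equality ε_k(G) = kν holds for every k although G^+ is empty, so the clause as written fails there. *)

theory Defs
  imports
    Complex_Main
    "HOL-Library.Ramsey"
    "HOL-Library.Multiset"
    "HOL-Computational_Algebra.Polynomial"
    "Jordan_Normal_Form.Char_Poly"
begin

section \<open>Finite simple graphs\<close>

text \<open>A graph is a pair of a vertex set and a set of edges; \<open>nsets V 2\<close> (from Ramsey theory) is the
  set of two-element subsets of \<open>V\<close>, so there are neither loops nor multiple edges.\<close>

type_synonym 'a ugraph = "'a set \<times> 'a set set"

abbreviation verts :: "'a ugraph \<Rightarrow> 'a set" where
  "verts G \<equiv> fst G"

abbreviation edges :: "'a ugraph \<Rightarrow> 'a set set" where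
  "edges G \<equiv> snd G"

definition simple_graph :: "'a ugraph \<Rightarrow> bool" where
  "simple_graph G \<longleftrightarrow> finite (verts G) \<and> edges G \<subseteq> nsets (verts G) 2"

definition vdegree :: "'a ugraph \<Rightarrow> 'a \<Rightarrow> nat" where
  "vdegree G v = card {e \<in> edges G. v \<in> e}"

definition induced_subgraph :: "'a ugraph \<Rightarrow> 'a set \<Rightarrow> 'a ugraph" where
  "induced_subgraph G U = (U, {e \<in> edges G. e \<subseteq> U})"

text \<open>The graph written $G^+$.\<close>

definition positive_part :: "'a ugraph \<Rightarrow> 'a ugraph" where
  "positive_part G = induced_subgraph G {v \<in> verts G. vdegree G v > 0}"

definition matching :: "'a ugraph \<Rightarrow> 'a set set \<Rightarrow> bool" where
  "matching G M \<longleftrightarrow> M \<subseteq> edges G \<and> pairwise disjnt M"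

definition matching_number :: "'a ugraph \<Rightarrow> nat" where
  "matching_number G = Max (card ` {M. matching G M})"

definition graph_iso :: "'a ugraph \<Rightarrow> 'b ugraph \<Rightarrow> bool" where
  "graph_iso G H \<longleftrightarrow>
     (\<exists>f. bij_betw f (verts G) (verts H) \<and>
          (\<forall>u \<in> verts G. \<forall>v \<in> verts G. {u, v} \<in> edges G \<longleftrightarrow> {f u, f v} \<in> edges H))"

definition complete_graph :: "nat \<Rightarrow> nat ugraph" where
  "complete_graph m = ({..<m}, nsets {..<m} 2)"

definition delete_edges :: "'a ugraph \<Rightarrow> 'a set set \<Rightarrow> 'a ugraph" where
  "delete_edges G F = (verts G, edges G - F)"

text \<open>The star $K_{1,t}$, with centre \<open>0\<close>.\<close>

definition star_graph :: "nat \<Rightarrow> nat ugraph" where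
  "star_graph t = ({0..t}, {{0, i} | i. i \<in> {1..t}})"


section \<open>Laplacian spectrum\<close>

text \<open>Matrices are indexed by natural numbers, so the vertices are listed in some order \<open>vs\<close>;
  a different order conjugates the matrices below by a permutation matrix.\<close>

definition vertex_list :: "'a ugraph \<Rightarrow> 'a list" where
  "vertex_list G = (SOME vs. distinct vs \<and> set vs = verts G)"

definition degree_matrix :: "'a ugraph \<Rightarrow> real mat" where
  "degree_matrix G = (let vs = vertex_list G in
     mat (length vs) (length vs) (\<lambda>(i, j). if i = j then real (vdegree G (vs ! i)) else 0))"

definition adjacency_matrix :: "'a ugraph \<Rightarrow> real mat" where
  "adjacency_matrix G = (let vs = vertex_list G in
     mat (length vs) (length vs) (\<lambda>(i, j). if {vs ! i, vs ! j} \<in> edges G then 1 else 0))"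

definition laplacian :: "'a ugraph \<Rightarrow> real mat" where
  "laplacian G = degree_matrix G - adjacency_matrix G"

text \<open>The real eigenvalues of a square matrix in non-increasing order, repeated according to their
  multiplicity as roots of the characteristic polynomial. For a symmetric real matrix of
  dimension \<open>n\<close> these are all of its eigenvalues, so the list has length \<open>n\<close>.\<close>

definition sorted_eigenvalues :: "real mat \<Rightarrow> real list" where
  "sorted_eigenvalues A = rev (sorted_list_of_multiset (proots (char_poly A)))"

text \<open>Eigenvalues are numbered from \<open>1\<close>.\<close>

definition eigenval :: "nat \<Rightarrow> real mat \<Rightarrow> real" where
  "eigenval j A = sorted_eigenvalues A ! (j - 1)"

definition laplacian_eps :: "nat \<Rightarrow> 'a ugraph \<Rightarrow> real" where
  "laplacian_eps k G =
     (\<Sum>j = 1..min k (card (verts G)). eigenval j (laplacian G)) - real (card (edges G))"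

end

theory Submission
  imports Defs "Jordan_Normal_Form.Schur_Decomposition"
begin

text \<open>
  At most \<open>n - 1\<close> Laplacian eigenvalues are nonzero if \<open>n \<ge> 1\<close>: every isolated vertex contributes a zero row,
  and the remaining rows add up to zero as well. All eigenvalues are nonnegative and they sum to the
  trace \<open>2 |E|\<close>, so for \<open>k \<ge> n - 1\<close> the \<open>k\<close> largest ones already have the full sum and
  \<open>\<epsilon>\<^sub>k(G) = |E|\<close> (lemma \<open>laplacian_eps_eq_card_edges\<close>). The theorem thereby becomes a comparison of
  \<open>|E|\<close> with \<open>k \<nu>\<close> for a graph on \<open>n\<close> vertices without isolated vertices.

  If \<open>n = 2 \<nu>\<close> or \<open>n = 2 \<nu> + 1\<close>, the trivial bound \<open>|E| \<le> n (n - 1) / 2\<close> decides everything;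
  it equals \<open>(n - 1) \<nu>\<close> in the first case and \<open>n \<nu>\<close> in the second, and the number of missing edges
  says on which side of \<open>(n - 1) \<nu>\<close> the graph lies. If \<open>n \<ge> 2 \<nu> + 2\<close>, fix a maximum matching \<open>M\<close>.
  The set \<open>U\<close> of vertices it misses is independent and has at least two elements. If both ends of an
  edge of \<open>M\<close> have neighbours in \<open>U\<close>, then these neighbours are one and the same vertex, since
  otherwise \<open>M\<close> could be enlarged; so each edge of \<open>M\<close> sends at most \<open>max {|U|, 2} = |U|\<close> edges
  to \<open>U\<close>. Adding the at most \<open>\<nu> (2 \<nu> - 1)\<close> edges inside the matched vertices gives
  \<open>|E| \<le> \<nu> (2 \<nu> - 1 + n - 2 \<nu>) = \<nu> (n - 1)\<close> (lemma \<open>card_edges_le\<close>). In case of equality the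
  matched vertices form a clique, and another augmentation shows that all edges to \<open>U\<close> leave the
  clique at a single vertex; there are thus at most \<open>|U|\<close> of them, which forces \<open>\<nu> = 1\<close> and a star
  (lemma \<open>extremal_imp_star\<close>).

  The graphs named in the theorem are recognised by their numbers of vertices and edges alone, except
  for the stars.
\<close>

section \<open>Maximum matchings and the number of edges\<close>

text \<open>
  Throughout, \<open>W\<close> is the set of matched vertices and \<open>U\<close> the set of vertices missed by \<open>M\<close>.
\<close>
locale maximum_matching =
  fixes V :: "'a set" and E M :: "'a set set"
  assumes finite_V: "finite V"
    and edges_nsets: "E \<subseteq> nsets V 2"
    and M_edges: "M \<subseteq> E"
    and M_disjnt: "pairwise disjnt M"
    and M_maximum: "\<And>M'. M' \<subseteq> E \<Longrightarrow> pairwise disjnt M' \<Longrightarrow> card M' \<le> card M"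
begin

abbreviation W :: "'a set" where "W \<equiv> \<Union>M"

abbreviation U :: "'a set" where "U \<equiv> V - W"

lemma finite_E: "finite E"
  using finite_subset[OF edges_nsets] finite_imp_finite_nsets[OF finite_V] by blast

lemma finite_M: "finite M"
  using finite_subset[OF M_edges finite_E] .

lemma edge_card: "e \<in> E \<Longrightarrow> card e = 2"
  using edges_nsets by (auto simp: nsets_def)

lemma edge_nonempty: "e \<in> E \<Longrightarrow> e \<noteq> {}"
  using edge_card by force

lemma edge_subset: "e \<in> E \<Longrightarrow> e \<subseteq> V"
  using edges_nsets by (auto simp: nsets_def)

lemma edge_cases:
  assumes "e \<in> E"
  obtains x y where "e = {x, y}" "x \<noteq> y" "x \<in> V" "y \<in> V"
  using edge_card[OF assms] edge_subset[OF assms] by (auto simp: card_2_iff)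

lemma edge_neq: "{x, y} \<in> E \<Longrightarrow> x \<noteq> y"
  using edge_card by fastforce

lemma W_subset: "W \<subseteq> V"
  using M_edges edge_subset by blast

lemma card_W: "card W = 2 * card M"
proof -
  have "finite e" if "e \<in> M" for e
    using that M_edges edge_subset finite_subset[OF _ finite_V] by blast
  then have "card W = (\<Sum>e\<in>M. card e)"
    by (rule card_Union_disjoint[OF M_disjnt])
  also have "\<dots> = (\<Sum>e\<in>M. 2)"
    using M_edges edge_card by (intro sum.cong) auto
  finally show ?thesis by simp
qed

lemma card_V: "card V = 2 * card M + card U"
  using card_W card_Diff_subset[OF finite_subset[OF W_subset finite_V] W_subset]
    card_mono[OF finite_V W_subset] by simp

text \<open>
  Exchanging \<open>R\<close> for \<open>A\<close> turns \<open>M\<close> into another matching, because the edges of \<open>A\<close> only use vertices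
  that are missed by \<open>M\<close> or set free by removing \<open>R\<close>. Every structural fact below is an instance
  in which \<open>A\<close> would have one edge more than \<open>R\<close>.
\<close>
lemma no_augmentation:
  assumes R: "R \<subseteq> M" and A: "A \<subseteq> E" "pairwise disjnt A" "\<Union>A \<subseteq> U \<union> \<Union>R"
  shows "card A \<le> card R"
proof -
  have sep: "disjnt a m" if "a \<in> A" "m \<in> M - R" for a m
  proof -
    have "disjnt r m" if "r \<in> R" for r
      using that \<open>m \<in> M - R\<close> R by (intro pairwiseD[OF M_disjnt]) auto
    then have "m \<inter> (U \<union> \<Union>R) = {}"
      using \<open>m \<in> M - R\<close> by (auto simp: disjnt_iff)
    moreover have "a \<subseteq> U \<union> \<Union>R" using \<open>a \<in> A\<close> A(3) by auto
    ultimately show ?thesis unfolding disjnt_def by blast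
  qed
  have "A \<inter> (M - R) = {}"
  proof (rule equals0I)
    fix a assume "a \<in> A \<inter> (M - R)"
    with sep[of a a] edge_nonempty[of a] A(1) show False by auto
  qed
  then have "card (A \<union> (M - R)) = card A + (card M - card R)"
    using finite_subset[OF A(1) finite_E] finite_M R
    by (simp add: card_Un_disjoint card_Diff_subset finite_subset)
  moreover have "card (A \<union> (M - R)) \<le> card M"
  proof (rule M_maximum)
    show "pairwise disjnt (A \<union> (M - R))"
      using A(2) M_disjnt sep unfolding pairwise_def by (auto simp: disjnt_sym)
  qed (use A(1) M_edges in auto)
  moreover have "card R \<le> card M"
    using R finite_M by (rule card_mono[rotated])
  ultimately show ?thesis by linarith
qed

lemma edge_meets_W:
  assumes "e \<in> E" shows "e \<inter> W \<noteq> {}"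
proof
  assume "e \<inter> W = {}"
  with assms have "card {e} \<le> card ({} :: 'a set set)"
    by (intro no_augmentation) (use edge_subset in auto)
  then show False by simp
qed

text \<open>
  Otherwise \<open>u\<close>, \<open>x\<close>, \<open>y\<close>, \<open>v\<close> is an augmenting path: its two outer edges may replace its middle
  edge.
\<close>
lemma common_outer_neighbour:
  assumes "{x, y} \<in> M" "{x, u} \<in> E" "{y, v} \<in> E" "u \<in> U" "v \<in> U"
  shows "u = v"
proof (rule ccontr)
  assume "u \<noteq> v"
  have xy: "x \<in> W" "y \<in> W" "x \<noteq> y"
    using assms(1) M_edges edge_neq by auto
  then have ne: "x \<noteq> v" "u \<noteq> y" "x \<noteq> u" "y \<noteq> v" using assms by auto
  have "card {{x, u}, {y, v}} \<le> card {{x, y}}"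
    by (rule no_augmentation)
      (use assms ne xy \<open>u \<noteq> v\<close> in \<open>auto simp: pairwise_def disjnt_def\<close>)
  then show False using xy ne by (simp add: doubleton_eq_iff)
qed

definition crossing :: "'a set \<Rightarrow> 'a set set" where
  "crossing e = {f \<in> E. f \<inter> e \<noteq> {} \<and> f \<inter> U \<noteq> {}}"

lemma crossing_cases:
  assumes e: "{x, y} \<in> M" and f: "f \<in> crossing {x, y}"
  obtains u where "u \<in> U" "f = {x, u}" | u where "u \<in> U" "f = {y, u}"
proof -
  from f have fE: "f \<in> E" and fe: "f \<inter> {x, y} \<noteq> {}" and "f \<inter> U \<noteq> {}"
    by (auto simp: crossing_def)
  then obtain u where u: "u \<in> f" "u \<in> U" by auto
  obtain a b where ab: "f = {a, b}" using edge_cases[OF fE] by metis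
  have "x \<in> W" "y \<in> W" using e by auto
  then have "f = {x, u} \<or> f = {y, u}" using ab u fe by auto
  with u that show ?thesis by blast
qed

text \<open>
  Either all crossing edges share one end of \<open>e\<close>, so that they are counted by their ends in \<open>U\<close>, or
  both ends of \<open>e\<close> have a neighbour in \<open>U\<close>. In the second case there is only one such neighbour,
  and at most two edges cross; this is where two unmatched vertices are required.
\<close>
lemma card_crossing_le:
  assumes e: "e \<in> M" and U: "2 \<le> card U"
  shows "card (crossing e) \<le> card U"
proof -
  have finU: "finite U" using finite_V by simp
  obtain x y where xy: "e = {x, y}" using e M_edges edge_cases by (metis subsetD)
  have star: "card (crossing e) \<le> card U" if pq: "e = {p, q}" and no_q: "\<forall>u\<in>U. {q, u} \<notin> E" for p q
  proof -
    have "crossing e \<subseteq> (\<lambda>u. {p, u}) ` U"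
    proof
      fix f assume f: "f \<in> crossing e"
      with e pq have "{p, q} \<in> M" "f \<in> crossing {p, q}" by simp_all
      then show "f \<in> (\<lambda>u. {p, u}) ` U"
      proof (cases rule: crossing_cases)
        case (2 u)
        then show ?thesis using no_q f by (auto simp: crossing_def)
      qed blast
    qed
    then show ?thesis by (rule surj_card_le[OF finU])
  qed
  consider (x) "\<forall>u\<in>U. {y, u} \<notin> E" | (y) "\<forall>u\<in>U. {x, u} \<notin> E"
    | (both) u v where "u \<in> U" "v \<in> U" "{y, u} \<in> E" "{x, v} \<in> E"
    by blast
  then show ?thesis
  proof cases
    case x
    with xy show ?thesis by (rule star)
  next
    case y
    with xy show ?thesis by (intro star[of y x]) auto
  next
    case both
    have uv: "u = v"
      using common_outer_neighbour[of x y v u] both e xy by auto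
    have "crossing e \<subseteq> {{x, u}, {y, u}}"
    proof
      fix f assume f: "f \<in> crossing e"
      then have "f \<in> E" by (simp add: crossing_def)
      from e xy f have "{x, y} \<in> M" "f \<in> crossing {x, y}" by simp_all
      then show "f \<in> {{x, u}, {y, u}}"
      proof (cases rule: crossing_cases)
        case (1 w)
        then show ?thesis
          using common_outer_neighbour[of x y w u] both e xy \<open>f \<in> E\<close> by auto
      next
        case (2 w)
        then show ?thesis
          using common_outer_neighbour[of x y v w] both e xy \<open>f \<in> E\<close> uv by auto
      qed
    qed
    then have "card (crossing e) \<le> card {{x, u}, {y, u}}"
      by (intro card_mono) auto
    also have "\<dots> \<le> 2" by (simp add: card_insert_if)
    finally show ?thesis using U by simp
  qed
qed

text \<open>
  An edge that is not inside \<open>W\<close> has an end in \<open>U\<close>; its other end is matched because \<open>U\<close> is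
  independent.
\<close>
lemma edges_split: "E = (E \<inter> nsets W 2) \<union> (\<Union>e\<in>M. crossing e)"
proof -
  have "f \<in> (\<Union>e\<in>M. crossing e)" if f: "f \<in> E" "f \<notin> nsets W 2" for f
  proof -
    have "\<not> f \<subseteq> W"
      using f edges_nsets finite_subset[OF W_subset finite_V] by (auto simp: nsets_def)
    then have "f \<inter> U \<noteq> {}" using edge_subset[OF f(1)] by auto
    then show ?thesis
      using edge_meets_W[OF f(1)] f(1) by (auto simp: crossing_def)
  qed
  then show ?thesis by (auto simp: crossing_def)
qed

lemma card_clique_part_le: "card (E \<inter> nsets W 2) \<le> card M * (2 * card M - 1)"
proof -
  have "card (E \<inter> nsets W 2) \<le> card (nsets W 2)"
    using finite_subset[OF W_subset finite_V]
    by (intro card_mono finite_imp_finite_nsets) auto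
  also have "\<dots> = card M * (2 * card M - 1)"
    by (simp add: card_W choose_two)
  finally show ?thesis .
qed

lemma card_crossings_le:
  assumes "2 \<le> card U"
  shows "card (\<Union>e\<in>M. crossing e) \<le> card M * card U"
proof -
  have "card (\<Union>e\<in>M. crossing e) \<le> (\<Sum>e\<in>M. card (crossing e))"
    by (rule card_UN_le[OF finite_M])
  also have "\<dots> \<le> (\<Sum>e\<in>M. card U)"
    by (intro sum_mono card_crossing_le assms)
  finally show ?thesis by simp
qed

lemma card_edges_le_sum:
  "card E \<le> card (E \<inter> nsets W 2) + card (\<Union>e\<in>M. crossing e)"
  by (subst edges_split) (rule card_Un_le)

lemma bound_split:
  "card M * (2 * card M - 1) + card M * card U = card M * (card V - 1)"
  by (cases "card M") (simp_all add: card_V algebra_simps)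

theorem card_edges_le:
  assumes "2 \<le> card U"
  shows "card E \<le> card M * (card V - 1)"
  using card_edges_le_sum card_clique_part_le card_crossings_le[OF assms] bound_split by linarith

lemma mate:
  assumes "a \<in> W"
  obtains a' where "{a, a'} \<in> M" "a \<noteq> a'"
proof -
  obtain m where m: "m \<in> M" "a \<in> m" using assms by auto
  obtain x y where "m = {x, y}" "x \<noteq> y" using m M_edges edge_cases by (metis subsetD)
  with m that show ?thesis by (metis insert_commute insert_iff singletonD)
qed

text \<open>
  If \<open>a \<noteq> b\<close>, their mates \<open>a'\<close> and \<open>b'\<close> are adjacent in the clique, so the two matching edges
  \<open>a a'\<close>, \<open>b b'\<close> can be exchanged for the three edges \<open>u a\<close>, \<open>a' b'\<close>, \<open>v b\<close>. When \<open>a\<close> and \<open>b\<close>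
  are themselves mates, the single edge \<open>a b\<close> gives way to \<open>u a\<close> and \<open>v b\<close>.
\<close>
lemma clique_outer_neighbour_unique:
  assumes clique: "nsets W 2 \<subseteq> E" and u: "u \<in> U" "{u, a} \<in> E" and v: "v \<in> U" "{v, b} \<in> E"
    and "u \<noteq> v"
  shows "a = b"
proof (rule ccontr)
  assume "a \<noteq> b"
  have aW: "a \<in> W" using edge_meets_W[OF u(2)] u by auto
  have bW: "b \<in> W" using edge_meets_W[OF v(2)] v by auto
  obtain a' where a': "{a, a'} \<in> M" "a \<noteq> a'" using mate[OF aW] .
  obtain b' where b': "{b, b'} \<in> M" "b \<noteq> b'" using mate[OF bW] .
  have W': "a' \<in> W" "b' \<in> W" using a' b' by auto
  show False
  proof (cases "a' = b")
    case True
    then show False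
      using common_outer_neighbour[of a b u v] a' u v \<open>u \<noteq> v\<close> by (simp add: insert_commute)
  next
    case False
    then have "{a, a'} \<noteq> {b, b'}" using \<open>a \<noteq> b\<close> by (auto simp: doubleton_eq_iff)
    then have "disjnt {a, a'} {b, b'}" using pairwiseD[OF M_disjnt] a' b' by blast
    then have ne: "a' \<noteq> b'" "a \<noteq> b'" by (auto simp: disjnt_def)
    have "card {{a', b'}, {u, a}, {v, b}} \<le> card {{a, a'}, {b, b'}}"
    proof (rule no_augmentation)
      have "{a', b'} \<in> E" using clique W' ne(1) by (meson doubleton_in_nsets_2 subsetD)
      then show "{{a', b'}, {u, a}, {v, b}} \<subseteq> E" using u v by auto
      show "pairwise disjnt {{a', b'}, {u, a}, {v, b}}"
        using ne a' b' u v aW bW W' False \<open>a \<noteq> b\<close> \<open>u \<noteq> v\<close>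
        by (auto simp: pairwise_def disjnt_def)
    qed (use a' b' u v in auto)
    moreover have "card {{a', b'}, {u, a}, {v, b}} = 3"
    proof -
      have "u \<noteq> a'" "u \<noteq> b'" "v \<noteq> a'" "v \<noteq> b'" "u \<noteq> b" "v \<noteq> a" using u v W' aW bW by auto
      then show ?thesis using \<open>u \<noteq> v\<close> by (simp add: doubleton_eq_iff)
    qed
    moreover have "card {{a, a'}, {b, b'}} \<le> 2" by (simp add: card_insert_if)
    ultimately show False by simp
  qed
qed

text \<open>
  Equality in the bound forces equality in both of its halves. The first says that \<open>W\<close> is a clique.
  Then all edges to \<open>U\<close> end in the same vertex \<open>a\<close>, so there are at most \<open>|U|\<close> of them, whereas the
  second half says that there are \<open>\<nu> |U|\<close>.
\<close>
theorem extremal_imp_star: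
  assumes U: "2 \<le> card U" and M: "1 \<le> card M"
    and cover: "\<And>v. v \<in> V \<Longrightarrow> \<exists>e\<in>E. v \<in> e"
    and eq: "card E = card M * (card V - 1)"
  shows "\<exists>a\<in>V. E = (\<lambda>w. {a, w}) ` (V - {a})"
proof -
  have finW: "finite W" using finite_subset[OF W_subset finite_V] .
  have inner: "card (E \<inter> nsets W 2) = card M * (2 * card M - 1)"
    and outer: "card (\<Union>e\<in>M. crossing e) = card M * card U"
    using card_edges_le_sum card_clique_part_le card_crossings_le[OF U] bound_split eq
    by linarith+
  have "card (E \<inter> nsets W 2) = card (nsets W 2)"
    using inner by (simp add: card_W choose_two)
  then have "E \<inter> nsets W 2 = nsets W 2"
    by (intro card_subset_eq finite_imp_finite_nsets finW) auto
  then have clique: "nsets W 2 \<subseteq> E" by auto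
  have nbr: "\<exists>b. {u, b} \<in> E" if u: "u \<in> U" for u
  proof -
    obtain e where e: "e \<in> E" "u \<in> e" using cover[of u] u by blast
    from e(1) obtain x y where "e = {x, y}" by (rule edge_cases)
    with e show ?thesis by (metis insert_commute insert_iff singletonD)
  qed
  obtain S where "S \<subseteq> U" "card S = 2" using obtain_subset_with_card_n[OF U] by metis
  then obtain u v where uv: "u \<in> U" "v \<in> U" "u \<noteq> v" by (auto simp: card_2_iff)
  obtain a where a: "{u, a} \<in> E" using nbr[OF uv(1)] ..
  have va: "{v, a} \<in> E"
    using nbr[OF uv(2)] clique_outer_neighbour_unique[OF clique uv(1) a uv(2) _ uv(3)] by metis
  have centre: "b = a" if "w \<in> U" "{w, b} \<in> E" for w b
  proof (cases "w = u")
    case True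
    then show ?thesis
      using clique_outer_neighbour_unique[OF clique that uv(2) va] uv(3) by auto
  next
    case False
    then show ?thesis
      using clique_outer_neighbour_unique[OF clique that uv(1) a] by auto
  qed
  have aW: "a \<in> W" using edge_meets_W[OF a] uv by auto
  have cross: "(\<Union>e\<in>M. crossing e) \<subseteq> (\<lambda>w. {a, w}) ` U"
  proof
    fix f assume "f \<in> (\<Union>e\<in>M. crossing e)"
    then obtain w where f: "f \<in> E" "w \<in> U" "w \<in> f" by (auto simp: crossing_def)
    from f(1) obtain x y where "f = {x, y}" by (rule edge_cases)
    with f obtain b where b: "f = {w, b}" by auto
    with f centre have "b = a" by blast
    with b have "f = {a, w}" by auto
    with f show "f \<in> (\<lambda>w. {a, w}) ` U" by blast
  qed
  have "card M * card U \<le> card U"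
    using surj_card_le[OF _ cross] outer finite_V by simp
  then have "card M = 1" using U M by (cases "card M") auto
  then obtain m where m: "M = {m}" by (auto simp: card_1_singleton_iff)
  obtain a' where a': "{a, a'} \<in> M" "a \<noteq> a'" using mate[OF aW] .
  then have Weq: "W = {a, a'}" using m by auto
  have "E = (\<lambda>w. {a, w}) ` (V - {a})"
  proof (intro equalityI subsetI)
    fix f assume f: "f \<in> E"
    show "f \<in> (\<lambda>w. {a, w}) ` (V - {a})"
    proof (cases "f \<in> nsets W 2")
      case True
      then have "f = {a, a'}" using a' by (simp add: Weq)
      then show ?thesis using a' W_subset Weq by auto
    next
      case False
      then show ?thesis using f edges_split cross aW by blast
    qed
  next
    fix f assume "f \<in> (\<lambda>w. {a, w}) ` (V - {a})"
    then obtain w where w: "w \<in> V" "w \<noteq> a" "f = {a, w}" by auto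
    show "f \<in> E"
    proof (cases "w \<in> U")
      case True
      then show ?thesis using nbr centre w by (metis insert_commute)
    next
      case False
      then have "w = a'" using w Weq by auto
      then show ?thesis using a' M_edges w by auto
    qed
  qed
  then show ?thesis using aW W_subset by blast
qed

end

section \<open>Characteristic polynomials with a high power of the variable\<close>

text \<open>
  In the Leibniz expansion every product takes one factor from each of these rows.
\<close>
lemma power_card_rows_dvd_det:
  fixes A :: "'a :: comm_ring_1 mat"
  assumes A: "A \<in> carrier_mat n n" and S: "S \<subseteq> {0..<n}"
    and x: "\<And>i j. i \<in> S \<Longrightarrow> j < n \<Longrightarrow> x dvd A $$ (i, j)"
  shows "x ^ card S dvd det A"
  unfolding det_def'[OF A]
proof (intro dvd_sum dvd_mult)
  fix p assume "p \<in> {p. p permutes {0..<n}}"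
  then have p: "p permutes {0..<n}" by simp
  have "x ^ card S = (\<Prod>i\<in>S. x)" by simp
  also have "\<dots> dvd (\<Prod>i\<in>S. A $$ (i, p i))"
  proof (intro prod_dvd_prod x)
    fix i assume "i \<in> S"
    then show "p i < n" using S permutes_in_image[OF p, of i] by auto
  qed
  also have "\<dots> dvd (\<Prod>i = 0..<n. A $$ (i, p i))"
    by (rule prod_dvd_prod_subset[OF _ S]) simp
  finally show "x ^ card S dvd (\<Prod>i = 0..<n. A $$ (i, p i))" .
qed

lemma char_poly_matrix_index:
  assumes "A \<in> carrier_mat n n" "i < n" "j < n"
  shows "char_poly_matrix A $$ (i, j) = (if i = j then [:0, 1:] else 0) - [:A $$ (i, j):]"
  using assms by (auto simp: char_poly_matrix_def)

lemma power_zero_rows_dvd_char_poly: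
  fixes A :: "'a :: comm_ring_1 mat"
  assumes A: "A \<in> carrier_mat n n" and S: "S \<subseteq> {0..<n}"
    and zero: "\<And>i j. i \<in> S \<Longrightarrow> j < n \<Longrightarrow> A $$ (i, j) = 0"
  shows "[:0, 1:] ^ card S dvd char_poly A"
  unfolding char_poly_def
  by (rule power_card_rows_dvd_det[of _ n])
    (use A S zero in \<open>auto simp: char_poly_matrix_index subset_iff\<close>)

text \<open>
  Besides the zero rows, a further row of the characteristic matrix can be made divisible by \<open>X\<close>:
  replacing row \<open>v\<close> by the sum of all rows does not change the determinant, and since the columns of
  \<open>A\<close> sum to zero, the new row is constantly \<open>X\<close>.
\<close>
lemma power_Suc_zero_rows_dvd_char_poly:
  fixes A :: "'a :: comm_ring_1 mat"
  assumes A: "A \<in> carrier_mat n n" and S: "S \<subseteq> {0..<n}"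
    and zero: "\<And>i j. i \<in> S \<Longrightarrow> j < n \<Longrightarrow> A $$ (i, j) = 0"
    and colsum: "\<And>j. j < n \<Longrightarrow> (\<Sum>i = 0..<n. A $$ (i, j)) = 0"
    and v: "v < n" "v \<notin> S"
  shows "[:0, 1:] ^ Suc (card S) dvd char_poly A"
proof -
  let ?X = "[:0, 1:] :: 'a poly"
  define C where "C = char_poly_matrix A"
  \<comment> \<open>Multiplication by \<open>P\<close> from the left replaces row \<open>v\<close> by the sum of all rows; \<open>Q\<close> is its inverse.\<close>
  define P :: "'a poly mat" where "P = mat n n (\<lambda>(i, j). if i = v \<or> i = j then 1 else 0)"
  define Q :: "'a poly mat" where
    "Q = mat n n (\<lambda>(i, j). if i = j then 1 else if i = v then - 1 else 0)"
  have C: "C \<in> carrier_mat n n" using A by (simp add: C_def)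
  have P: "P \<in> carrier_mat n n" and Q: "Q \<in> carrier_mat n n" by (simp_all add: P_def Q_def)
  have QP: "Q * P = 1\<^sub>m n"
  proof (rule eq_matI)
    fix i j assume "i < dim_row (1\<^sub>m n :: 'a poly mat)" "j < dim_col (1\<^sub>m n :: 'a poly mat)"
    then have ij: "i < n" "j < n" by auto
    have "(Q * P) $$ (i, j) = (\<Sum>k = 0..<n. Q $$ (i, k) * P $$ (k, j))"
      using ij P Q by (simp add: scalar_prod_def)
    also have "\<dots> = (if i = j then 1 else 0)"
    proof (cases "i = v")
      case False
      then have "(\<Sum>k = 0..<n. Q $$ (i, k) * P $$ (k, j)) = (\<Sum>k = 0..<n. if k = i then P $$ (i, j) else 0)"
        using ij by (intro sum.cong) (auto simp: Q_def)
      then show ?thesis using False ij by (simp add: P_def)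
    next
      case True
      have "(\<Sum>k = 0..<n. Q $$ (i, k) * P $$ (k, j))
          = Q $$ (v, v) * P $$ (v, j) + (\<Sum>k \<in> {0..<n} - {v}. Q $$ (v, k) * P $$ (k, j))"
        unfolding True using v by (intro sum.remove) auto
      also have "(\<Sum>k \<in> {0..<n} - {v}. Q $$ (v, k) * P $$ (k, j))
          = (\<Sum>k \<in> {0..<n} - {v}. if k = j then - 1 else 0)"
        using ij v by (intro sum.cong) (auto simp: Q_def P_def)
      also have "\<dots> = (if j = v then 0 else - 1)" using ij by (simp add: sum.delta)
      finally show ?thesis using ij v True by (auto simp: Q_def P_def)
    qed
    finally show "(Q * P) $$ (i, j) = 1\<^sub>m n $$ (i, j)" using ij by simp
  qed (use P Q in auto)
  have unit: "det Q * det P = 1"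
    using det_mult[OF Q P] QP by simp
  have const: "(\<Sum>k\<in>K. [:g k:]) = [:\<Sum>k\<in>K. g k:]" for K :: "nat set" and g :: "nat \<Rightarrow> 'a"
    by (induction K rule: infinite_finite_induct) auto
  have PC: "(P * C) $$ (i, j) = (if i = v then ?X else C $$ (i, j))" if ij: "i < n" "j < n" for i j
  proof -
    have eq: "(P * C) $$ (i, j) = (\<Sum>k = 0..<n. P $$ (i, k) * C $$ (k, j))"
      using ij P C by (simp add: scalar_prod_def)
    show ?thesis
    proof (cases "i = v")
      case False
      then have "(\<Sum>k = 0..<n. P $$ (i, k) * C $$ (k, j)) = (\<Sum>k = 0..<n. if k = i then C $$ (i, j) else 0)"
        using ij by (intro sum.cong) (auto simp: P_def)
      then show ?thesis using False ij eq by simp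
    next
      case True
      then have "(\<Sum>k = 0..<n. P $$ (i, k) * C $$ (k, j))
          = (\<Sum>k = 0..<n. (if k = j then ?X else 0) - [:A $$ (k, j):])"
        using ij A by (intro sum.cong) (auto simp: P_def C_def char_poly_matrix_index)
      also have "\<dots> = ?X - [:\<Sum>k = 0..<n. A $$ (k, j):]"
        using ij by (simp add: sum_subtractf const)
      finally show ?thesis using True eq colsum[OF ij(2)] by simp
    qed
  qed
  have "?X ^ card (insert v S) dvd det (P * C)"
  proof (rule power_card_rows_dvd_det[of _ n])
    fix i j assume "i \<in> insert v S" "j < n"
    then show "?X dvd (P * C) $$ (i, j)"
      using PC[of i j] zero[of i j] S v A by (auto simp: C_def char_poly_matrix_index subset_iff)
  qed (use P C S v in auto)
  also have "card (insert v S) = Suc (card S)" using v finite_subset[OF S] by simp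
  finally have "?X ^ Suc (card S) dvd det Q * (det P * det C)"
    using det_mult[OF P C] by simp
  also have "det Q * (det P * det C) = char_poly A"
    using unit by (simp add: C_def char_poly_def mult.assoc[symmetric])
  finally show ?thesis .
qed

section \<open>Sums of eigenvalues\<close>

lemma trace_mult_comm:
  fixes A B :: "'a :: comm_ring_1 mat"
  assumes "A \<in> carrier_mat n n" "B \<in> carrier_mat n n"
  shows "(\<Sum>i = 0..<n. (A * B) $$ (i, i)) = (\<Sum>i = 0..<n. (B * A) $$ (i, i))"
proof -
  have "(\<Sum>i = 0..<n. (A * B) $$ (i, i)) = (\<Sum>i = 0..<n. \<Sum>j = 0..<n. A $$ (i, j) * B $$ (j, i))"
    using assms by (simp add: scalar_prod_def)
  also have "\<dots> = (\<Sum>j = 0..<n. \<Sum>i = 0..<n. B $$ (j, i) * A $$ (i, j))"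
    by (subst sum.swap) (simp add: mult.commute)
  also have "\<dots> = (\<Sum>i = 0..<n. (B * A) $$ (i, i))"
    using assms by (simp add: scalar_prod_def)
  finally show ?thesis .
qed

text \<open>
  The diagonal of a Schur triangular form lists the roots of the characteristic polynomial, and the
  trace is invariant under similarity.
\<close>
lemma sum_eigenvalues_eq_trace:
  fixes A :: "'a :: conjugatable_ordered_field mat"
  assumes A: "A \<in> carrier_mat n n" and cp: "char_poly A = (\<Prod>e\<leftarrow>es. [:- e, 1:])"
  shows "sum_list es = (\<Sum>i = 0..<n. A $$ (i, i))"
proof -
  obtain B P Q where dec: "schur_decomposition A es = (B, P, Q)" by (cases "schur_decomposition A es")
  from schur_decomposition[OF A cp dec]
  have sim: "similar_mat_wit A B P Q" and diag: "diag_mat B = es" by auto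
  from similar_mat_witD2[OF A sim]
  have AB: "A = P * B * Q" and QP: "Q * P = 1\<^sub>m n"
    and car: "B \<in> carrier_mat n n" "P \<in> carrier_mat n n" "Q \<in> carrier_mat n n" by auto
  have "(\<Sum>i = 0..<n. A $$ (i, i)) = (\<Sum>i = 0..<n. (Q * (P * B)) $$ (i, i))"
    unfolding AB using car by (intro trace_mult_comm) auto
  also have "Q * (P * B) = (Q * P) * B" using car by simp
  also have "\<dots> = B" using car by (simp add: QP)
  also have "(\<Sum>i = 0..<n. B $$ (i, i)) = sum_list (diag_mat B)"
    using car by (simp add: diag_mat_def interv_sum_list_conv_sum_set_nat)
  finally show ?thesis using diag by simp
qed

text \<open>
  The divisibility assumption says that at least \<open>length es - k\<close> of the eigenvalues vanish. As the others
  are nonnegative, the zeros come last in decreasing order, and cutting the list after \<open>k\<close> entries loses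
  nothing.
\<close>
lemma sum_largest_eigenvalues:
  fixes A :: "real mat"
  assumes cp: "char_poly A = (\<Prod>e\<leftarrow>es. [:- e, 1:])" and nonneg: "\<And>e. e \<in> set es \<Longrightarrow> 0 \<le> e"
    and zeros: "[:0, 1:] ^ (length es - k) dvd char_poly A"
  shows "(\<Sum>j = 1..min k (length es). eigenval j A) = sum_list es"
proof -
  define xs where "xs = sorted_eigenvalues A"
  define N where "N = length es"
  have ne: "char_poly A \<noteq> 0" unfolding cp by (auto simp: prod_list_zero_iff)
  have proots: "proots (char_poly A) = mset es"
    unfolding cp
  proof (induction es)
    case (Cons a es)
    have "(\<Prod>e\<leftarrow>es. [:- e, 1:]) \<noteq> 0" by (auto simp: prod_list_zero_iff)
    with Cons show ?case by (simp add: proots_mult del: mult_pCons_left mult_pCons_right)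
  qed simp
  from proots have mset_xs: "mset xs = mset es" and sorted: "sorted (rev xs)"
    by (simp_all add: xs_def sorted_eigenvalues_def)
  have len: "length xs = N" and set_xs: "set xs = set es"
    using mset_xs by (auto simp: N_def dest: mset_eq_length mset_eq_setD)
  have "N - k \<le> Polynomial.order 0 (char_poly A)"
    using zeros ne order_divides[of 0 "N - k" "char_poly A"] by (simp add: N_def)
  also have "\<dots> = count (mset xs) 0"
    unfolding mset_xs proots[symmetric] using ne by simp
  also have "\<dots> = card {i. i < N \<and> xs ! i = 0}"
    unfolding count_mset count_list_eq_length_filter length_filter_conv_card len
    by (rule arg_cong[of _ _ card]) auto
  finally have card_zeros: "N - k \<le> card {i. i < N \<and> xs ! i = 0}" .
  have tail: "xs ! i = 0" if i: "k \<le> i" "i < N" for i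
  proof (rule ccontr)
    assume "xs ! i \<noteq> 0"
    then have pos: "xs ! i > 0"
      using nonneg[of "xs ! i"] i set_xs len nth_mem[of i xs] by auto
    have "xs ! i \<le> xs ! j" if "j \<le> i" for j
      using sorted_rev_nth_mono[OF sorted that] i len by simp
    then have "{j. j < N \<and> xs ! j = 0} \<subseteq> {Suc i..<N}"
      using pos by (force simp: not_less_eq_eq[symmetric])
    then have "card {j. j < N \<and> xs ! j = 0} \<le> N - Suc i"
      using card_mono[of "{Suc i..<N}"] by fastforce
    with card_zeros i show False by linarith
  qed
  have "(\<Sum>j = 1..min k N. eigenval j A) = (\<Sum>i = 0..<min k N. xs ! i)"
    by (rule sum.reindex_bij_witness[of _ Suc "\<lambda>j. j - 1"])
      (auto simp: eigenval_def xs_def)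
  also have "\<dots> = (\<Sum>i = 0..<N. xs ! i)"
    by (rule sum.mono_neutral_left) (auto intro!: tail simp: min_def split: if_splits)
  also have "\<dots> = sum_list xs" by (simp add: sum_list_sum_nth len)
  also have "\<dots> = sum_list es" using mset_xs by (metis sum_mset_sum_list)
  finally show ?thesis by (simp add: N_def)
qed

section \<open>The spectrum of a weighted Laplacian\<close>

text \<open>
  The Laplacian of a weighted graph on the vertices \<open>0, ..., n - 1\<close>.
\<close>
definition weighted_laplacian :: "nat \<Rightarrow> (nat \<Rightarrow> nat \<Rightarrow> real) \<Rightarrow> real mat" where
  "weighted_laplacian n w =
     mat n n (\<lambda>(i, j). (if i = j then \<Sum>k = 0..<n. w i k else 0) - w i j)"

text \<open>
  The sum on the left is \<open>f\<^sup>* L f\<close>. Expanding it as a double sum over \<open>w\<^sub>i\<^sub>j cnj (f\<^sub>i) (f\<^sub>i - f\<^sub>j)\<close> and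
  adding the same sum with \<open>i\<close> and \<open>j\<close> exchanged produces the squares.
\<close>
lemma weighted_laplacian_quadratic_form:
  fixes f :: "nat \<Rightarrow> complex"
  assumes sym: "\<And>i j. w i j = w j i"
  shows "2 * (\<Sum>i = 0..<n. cnj (f i) * (\<Sum>j = 0..<n. of_real (weighted_laplacian n w $$ (i, j)) * f j))
    = of_real (\<Sum>i = 0..<n. \<Sum>j = 0..<n. w i j * (cmod (f i - f j))\<^sup>2)"
proof -
  have row: "(\<Sum>j = 0..<n. of_real (weighted_laplacian n w $$ (i, j)) * f j)
      = (\<Sum>j = 0..<n. of_real (w i j) * (f i - f j))" if i: "i < n" for i
  proof -
    have "(\<Sum>j = 0..<n. of_real (weighted_laplacian n w $$ (i, j)) * f j)
        = (\<Sum>j = 0..<n. (if j = i then of_real (\<Sum>k = 0..<n. w i k) * f i else 0) - of_real (w i j) * f j)"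
      using i by (intro sum.cong) (auto simp: weighted_laplacian_def algebra_simps)
    also have "\<dots> = of_real (\<Sum>k = 0..<n. w i k) * f i - (\<Sum>j = 0..<n. of_real (w i j) * f j)"
      using i by (simp add: sum_subtractf)
    finally show ?thesis
      by (simp add: sum_subtractf right_diff_distrib sum_distrib_right)
  qed
  define q where "q = (\<Sum>i = 0..<n. \<Sum>j = 0..<n. of_real (w i j) * (cnj (f i) * (f i - f j)))"
  have "(\<Sum>i = 0..<n. cnj (f i) * (\<Sum>j = 0..<n. of_real (weighted_laplacian n w $$ (i, j)) * f j)) = q"
    unfolding q_def using row by (intro sum.cong) (auto simp: sum_distrib_left algebra_simps)
  moreover have "q = (\<Sum>i = 0..<n. \<Sum>j = 0..<n. of_real (w i j) * (cnj (f j) * (f j - f i)))"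
    unfolding q_def by (subst sum.swap) (simp add: sym)
  then have "2 * q = (\<Sum>i = 0..<n. \<Sum>j = 0..<n. of_real (w i j) * (cnj (f i) * (f i - f j)) +
      of_real (w i j) * (cnj (f j) * (f j - f i)))"
    unfolding sum.distrib q_def[symmetric] by simp
  also have "\<dots> = (\<Sum>i = 0..<n. \<Sum>j = 0..<n. of_real (w i j * (cmod (f i - f j))\<^sup>2))"
  proof (intro sum.cong refl)
    fix i j
    show "of_real (w i j) * (cnj (f i) * (f i - f j)) + of_real (w i j) * (cnj (f j) * (f j - f i))
      = of_real (w i j * (cmod (f i - f j))\<^sup>2)"
      unfolding of_real_mult complex_norm_square by (simp add: algebra_simps)
  qed
  ultimately show ?thesis by simp
qed

lemma weighted_laplacian_carrier [simp]: "weighted_laplacian n w \<in> carrier_mat n n"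
  by (simp add: weighted_laplacian_def)

text \<open>
  The quadratic form at an eigenvector \<open>f\<close> is \<open>a\<close> times the squared norm of \<open>f\<close>, and it is real and
  nonnegative. Reality of the eigenvalue and its sign are thus obtained in one step.
\<close>
lemma complex_eigenvalue_weighted_laplacian:
  assumes sym: "\<And>i j. w i j = w j i" and nonneg: "\<And>i j. 0 \<le> w i j"
    and ev: "eigenvalue (map_mat complex_of_real (weighted_laplacian n w)) a"
  shows "\<exists>r \<ge> 0. a = of_real r"
proof -
  let ?A = "map_mat complex_of_real (weighted_laplacian n w)"
  have dims: "dim_row ?A = n" "dim_col ?A = n" by (auto simp: weighted_laplacian_def)
  obtain v where v: "v \<in> carrier_vec n" "v \<noteq> 0\<^sub>v n" "?A *\<^sub>v v = a \<cdot>\<^sub>v v"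
    using ev unfolding eigenvalue_def eigenvector_def dims by auto
  define f where "f i = v $ i" for i
  have Av: "(\<Sum>j = 0..<n. of_real (weighted_laplacian n w $$ (i, j)) * f j) = a * f i" if i: "i < n" for i
  proof -
    have "(?A *\<^sub>v v) $ i = (\<Sum>j = 0..<n. ?A $$ (i, j) * v $ j)"
      using i v(1) dims by (auto simp: scalar_prod_def)
    also have "\<dots> = (\<Sum>j = 0..<n. of_real (weighted_laplacian n w $$ (i, j)) * f j)"
      using i by (intro sum.cong) (auto simp: f_def weighted_laplacian_def)
    finally show ?thesis using v i by (simp add: f_def)
  qed
  define s where "s = (\<Sum>i = 0..<n. (cmod (f i))\<^sup>2)"
  define T where "T = (\<Sum>i = 0..<n. \<Sum>j = 0..<n. w i j * (cmod (f i - f j))\<^sup>2)"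
  have "(\<Sum>i = 0..<n. cnj (f i) * (\<Sum>j = 0..<n. of_real (weighted_laplacian n w $$ (i, j)) * f j))
      = (\<Sum>i = 0..<n. a * of_real ((cmod (f i))\<^sup>2))"
  proof (rule sum.cong)
    fix i assume "i \<in> {0..<n}"
    then show "cnj (f i) * (\<Sum>j = 0..<n. of_real (weighted_laplacian n w $$ (i, j)) * f j)
        = a * of_real ((cmod (f i))\<^sup>2)"
      unfolding complex_norm_square by (simp add: Av)
  qed simp
  also have "\<dots> = a * of_real s" by (simp add: s_def sum_distrib_left)
  finally have eq: "2 * (a * of_real s) = of_real T"
    using weighted_laplacian_quadratic_form[where w = w and n = n and f = f, OF sym] by (simp add: T_def)
  obtain i where i: "i < n" "f i \<noteq> 0"
    using v(1,2) unfolding f_def by (metis carrier_vecD eq_vecI index_zero_vec)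
  have "0 < s" unfolding s_def
    by (rule sum_pos2[of _ i]) (use i in auto)
  then have "a = of_real (T / (2 * s))"
    using eq by (simp add: field_simps)
  moreover have "0 \<le> T" unfolding T_def
    by (intro sum_nonneg mult_nonneg_nonneg nonneg) auto
  ultimately show ?thesis using \<open>0 < s\<close> by (intro exI[of _ "T / (2 * s)"]) simp
qed

text \<open>
  Over the complex numbers the characteristic polynomial splits. Its roots are real, so it already
  splits over the reals.
\<close>
lemma weighted_laplacian_char_poly_splits:
  assumes sym: "\<And>i j. w i j = w j i" and nonneg: "\<And>i j. 0 \<le> w i j"
  obtains es where "char_poly (weighted_laplacian n w) = (\<Prod>e\<leftarrow>es. [:- e, 1:])"
    and "length es = n" and "\<And>e. e \<in> set es \<Longrightarrow> 0 \<le> e"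
proof -
  interpret map_hom: map_poly_inj_idom_hom complex_of_real ..
  let ?L = "weighted_laplacian n w"
  let ?A = "map_mat complex_of_real ?L"
  have A: "?A \<in> carrier_mat n n" by simp
  obtain as where as: "char_poly ?A = (\<Prod>a\<leftarrow>as. [:- a, 1:])" "length as = n"
    using char_poly_factorized[OF A] by blast
  have real: "\<exists>r \<ge> 0. a = of_real r" if "a \<in> set as" for a
  proof (rule complex_eigenvalue_weighted_laplacian[OF sym nonneg])
    have "poly (char_poly ?A) a = 0"
      unfolding as(1) using linear_poly_root[OF that] by simp
    then show "eigenvalue ?A a" using eigenvalue_root_char_poly[OF A] by simp
  qed
  have "map_poly complex_of_real (char_poly ?L) = (\<Prod>a\<leftarrow>as. [:- a, 1:])"
    unfolding as(1)[symmetric] by (rule of_real_hom.char_poly_hom[of _ n, symmetric]) simp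
  also have "\<dots> = (\<Prod>a\<leftarrow>as. map_poly complex_of_real [:- Re a, 1:])"
    by (intro arg_cong[of _ _ prod_list] map_cong refl) (use real in force)
  also have "\<dots> = map_poly complex_of_real (\<Prod>a\<leftarrow>as. [:- Re a, 1:])"
    by (simp add: map_hom.hom_prod_list o_def)
  finally have "char_poly ?L = (\<Prod>a\<leftarrow>as. [:- Re a, 1:])"
    by simp
  then show thesis
    using real as(2) by (intro that[of "map Re as"]) (force simp: o_def)+
qed

section \<open>The Laplacian spectrum of a graph\<close>

lemma vertex_list:
  assumes "simple_graph G"
  shows "distinct (vertex_list G)" "set (vertex_list G) = verts G"
    "length (vertex_list G) = card (verts G)"
proof -
  have "\<exists>vs. distinct vs \<and> set vs = verts G"
    using assms finite_distinct_list[of "verts G"] by (auto simp: simple_graph_def)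
  from someI_ex[OF this]
  show *: "distinct (vertex_list G)" "set (vertex_list G) = verts G"
    by (auto simp: vertex_list_def)
  show "length (vertex_list G) = card (verts G)"
    using distinct_card[OF *(1)] *(2) by simp
qed

lemma simple_graph_edge_subset: "simple_graph G \<Longrightarrow> e \<in> edges G \<Longrightarrow> e \<subseteq> verts G"
  by (auto simp: simple_graph_def nsets_def)

lemma simple_graph_finite_edges: "simple_graph G \<Longrightarrow> finite (edges G)"
  by (auto simp: simple_graph_def intro: finite_subset finite_imp_finite_nsets)

lemma simple_graph_edge_neq: "simple_graph G \<Longrightarrow> {u, v} \<in> edges G \<Longrightarrow> u \<noteq> v"
  by (metis doubleton_in_nsets_2 simple_graph_def subsetD)

lemma vdegree_eq_card_neighbours:
  assumes G: "simple_graph G"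
  shows "vdegree G v = card {u \<in> verts G. {v, u} \<in> edges G}"
proof -
  have "{e \<in> edges G. v \<in> e} = (\<lambda>u. {v, u}) ` {u \<in> verts G. {v, u} \<in> edges G}"
  proof (intro equalityI subsetI)
    fix e assume e: "e \<in> {e \<in> edges G. v \<in> e}"
    then have "e \<in> nsets (verts G) 2" using G by (auto simp: simple_graph_def)
    then obtain x y where "e = {x, y}" "x \<in> verts G" "y \<in> verts G"
      by (auto simp: nsets_2_eq)
    with e show "e \<in> (\<lambda>u. {v, u}) ` {u \<in> verts G. {v, u} \<in> edges G}"
      by (auto simp: insert_commute)
  qed auto
  moreover have "inj_on (\<lambda>u. {v, u}) {u \<in> verts G. {v, u} \<in> edges G}"
    by (auto simp: inj_on_def doubleton_eq_iff)
  ultimately show ?thesis by (simp add: vdegree_def card_image)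
qed

lemma sum_vdegree:
  assumes G: "simple_graph G"
  shows "(\<Sum>v\<in>verts G. vdegree G v) = 2 * card (edges G)"
proof -
  have "(\<Sum>v\<in>verts G. card {e \<in> edges G. v \<in> e}) = 2 * card (edges G)"
  proof (rule sum_multicount)
    show "\<forall>e\<in>edges G. card {v \<in> verts G. v \<in> e} = 2"
    proof
      fix e assume e: "e \<in> edges G"
      then have "{v \<in> verts G. v \<in> e} = e" using simple_graph_edge_subset[OF G] by auto
      then show "card {v \<in> verts G. v \<in> e} = 2" using e G by (auto simp: simple_graph_def nsets_def)
    qed
  qed (use G in \<open>auto simp: simple_graph_def simple_graph_finite_edges\<close>)
  then show ?thesis by (simp add: vdegree_def)
qed

text \<open>
  The rows and columns of the Laplacian follow \<open>vertex_list\<close>, so the adjacency relation has to be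
  transported to list positions.
\<close>
definition adjacency_weight :: "'a ugraph \<Rightarrow> nat \<Rightarrow> nat \<Rightarrow> real" where
  "adjacency_weight G i j = (if {vertex_list G ! i, vertex_list G ! j} \<in> edges G then 1 else 0)"

lemma adjacency_weight_commute: "adjacency_weight G i j = adjacency_weight G j i"
  by (simp add: adjacency_weight_def insert_commute)

lemma adjacency_weight_nonneg: "0 \<le> adjacency_weight G i j"
  by (simp add: adjacency_weight_def)

lemma adjacency_weight_self: "simple_graph G \<Longrightarrow> adjacency_weight G i i = 0"
  using simple_graph_edge_neq[of G "vertex_list G ! i" "vertex_list G ! i"]
  by (auto simp: adjacency_weight_def)

lemma sum_vertex_list:
  assumes "simple_graph G"
  shows "(\<Sum>i = 0..<card (verts G). f (vertex_list G ! i)) = (\<Sum>v\<in>verts G. f v)"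
  using sum.reindex_bij_betw[OF bij_betw_nth[OF vertex_list(1)[OF assms] refl refl], of f]
  by (simp add: vertex_list[OF assms] atLeast0LessThan)

lemma sum_adjacency_weight:
  assumes G: "simple_graph G"
  shows "(\<Sum>j = 0..<card (verts G). adjacency_weight G i j) = real (vdegree G (vertex_list G ! i))"
proof -
  have "(\<Sum>j = 0..<card (verts G). adjacency_weight G i j)
      = (\<Sum>u\<in>verts G. if {vertex_list G ! i, u} \<in> edges G then 1 else 0)"
    unfolding adjacency_weight_def by (rule sum_vertex_list[OF G])
  also have "\<dots> = real (card {u \<in> verts G. {vertex_list G ! i, u} \<in> edges G})"
    using G by (simp add: sum.inter_filter[symmetric] simple_graph_def)
  finally show ?thesis by (simp add: vdegree_eq_card_neighbours[OF G])
qed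

lemma laplacian_eq_weighted_laplacian:
  assumes G: "simple_graph G"
  shows "laplacian G = weighted_laplacian (card (verts G)) (adjacency_weight G)"
proof (rule eq_matI)
  let ?N = "card (verts G)"
  fix i j assume "i < dim_row (weighted_laplacian ?N (adjacency_weight G))"
    and "j < dim_col (weighted_laplacian ?N (adjacency_weight G))"
  then have ij: "i < ?N" "j < ?N" by (simp_all add: weighted_laplacian_def)
  have "adjacency_matrix G $$ (i, j) = adjacency_weight G i j"
    using ij by (simp add: adjacency_matrix_def Let_def vertex_list(3)[OF G] adjacency_weight_def)
  then show "laplacian G $$ (i, j) = weighted_laplacian ?N (adjacency_weight G) $$ (i, j)"
    using ij by (simp add: laplacian_def degree_matrix_def adjacency_matrix_def Let_def
        vertex_list(3)[OF G] weighted_laplacian_def sum_adjacency_weight[OF G])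
qed (simp_all add: laplacian_def degree_matrix_def adjacency_matrix_def Let_def
    vertex_list(3)[OF G] weighted_laplacian_def)

lemma trace_laplacian:
  assumes G: "simple_graph G"
  shows "(\<Sum>i = 0..<card (verts G). laplacian G $$ (i, i)) = 2 * real (card (edges G))"
proof -
  have "(\<Sum>i = 0..<card (verts G). laplacian G $$ (i, i))
      = (\<Sum>i = 0..<card (verts G). real (vdegree G (vertex_list G ! i)))"
  proof (rule sum.cong)
    fix i assume "i \<in> {0..<card (verts G)}"
    then show "laplacian G $$ (i, i) = real (vdegree G (vertex_list G ! i))"
      by (simp add: laplacian_eq_weighted_laplacian[OF G] weighted_laplacian_def
          sum_adjacency_weight[OF G] adjacency_weight_self[OF G])
  qed simp
  also have "\<dots> = real (\<Sum>v\<in>verts G. vdegree G v)"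
    unfolding of_nat_sum by (rule sum_vertex_list[OF G])
  finally show ?thesis by (simp add: sum_vdegree[OF G])
qed

text \<open>
  Natural subtraction makes the exponent right in both cases: without edges all \<open>|V|\<close> rows vanish,
  and otherwise one factor is gained from the vanishing column sums in addition to the isolated vertices.
\<close>
lemma power_dvd_char_poly_laplacian:
  assumes G: "simple_graph G"
  shows "[:0, 1:] ^ (card (verts G) - (card {v \<in> verts G. 0 < vdegree G v} - 1)) dvd char_poly (laplacian G)"
proof -
  define N where "N = card (verts G)"
  define vs where "vs = vertex_list G"
  define S where "S = {i \<in> {0..<N}. vdegree G (vs ! i) = 0}"
  note L = laplacian_eq_weighted_laplacian[OF G, folded N_def]
  have A: "laplacian G \<in> carrier_mat N N" by (simp add: L)
  have S: "S \<subseteq> {0..<N}" by (auto simp: S_def)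
  have bij: "bij_betw ((!) vs) {0..<N} (verts G)"
    using bij_betw_nth[OF vertex_list(1)[OF G] refl refl] vertex_list[OF G]
    by (simp add: vs_def N_def atLeast0LessThan)
  have "bij_betw ((!) vs) ({0..<N} - S) {v \<in> verts G. 0 < vdegree G v}"
  proof (rule bij_betw_subset[OF bij])
    show "(!) vs ` ({0..<N} - S) = {v \<in> verts G. 0 < vdegree G v}"
      unfolding bij_betw_imp_surj_on[OF bij, symmetric] by (auto simp: S_def)
  qed (simp add: S_def)
  from bij_betw_same_card[OF this]
  have pos: "card {v \<in> verts G. 0 < vdegree G v} = N - card S"
    using S by (simp add: card_Diff_subset finite_subset)
  have zero: "laplacian G $$ (i, j) = 0" if "i \<in> S" "j < N" for i j
  proof -
    have i: "i < N" using that by (simp add: S_def)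
    have deg0: "(\<Sum>k = 0..<N. adjacency_weight G i k) = 0"
      using that sum_adjacency_weight[OF G, of i] by (simp add: S_def N_def vs_def)
    then have "adjacency_weight G i j = 0"
      using that(2) by (subst (asm) sum_nonneg_eq_0_iff) (auto simp: adjacency_weight_nonneg[of G])
    then show ?thesis using i that(2) deg0 by (cases "i = j") (simp_all add: L weighted_laplacian_def)
  qed
  have colsum: "(\<Sum>i = 0..<N. laplacian G $$ (i, j)) = 0" if j: "j < N" for j
  proof -
    have "(\<Sum>i = 0..<N. laplacian G $$ (i, j))
      = (\<Sum>i = 0..<N. (if i = j then \<Sum>k = 0..<N. adjacency_weight G j k else 0) - adjacency_weight G j i)"
      using j by (intro sum.cong) (auto simp: L weighted_laplacian_def adjacency_weight_commute)
    then show ?thesis using j by (simp add: sum_subtractf)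
  qed
  show ?thesis
  proof (cases "S = {0..<N}")
    case True
    then show ?thesis
      using power_zero_rows_dvd_char_poly[OF A S zero] pos by (simp add: N_def)
  next
    case False
    then obtain v where v: "v < N" "v \<notin> S" using S by fastforce
    have "S \<subset> {0..<N}" using S False by blast
    then have "card S < N" using psubset_card_mono[of "{0..<N}" S] by simp
    then have "N - (card {v \<in> verts G. 0 < vdegree G v} - 1) = Suc (card S)"
      using pos by simp
    then show ?thesis
      using power_Suc_zero_rows_dvd_char_poly[OF A S zero colsum v] by (simp add: N_def)
  qed
qed

lemma laplacian_eps_eq_card_edges:
  assumes G: "simple_graph G" and k: "card {v \<in> verts G. 0 < vdegree G v} - 1 \<le> k"
  shows "laplacian_eps k G = real (card (edges G))"
proof -
  let ?N = "card (verts G)"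
  note L = laplacian_eq_weighted_laplacian[OF G]
  obtain es where cp: "char_poly (laplacian G) = (\<Prod>e\<leftarrow>es. [:- e, 1:])"
    and len: "length es = ?N" and nonneg: "\<And>e. e \<in> set es \<Longrightarrow> 0 \<le> e"
    using weighted_laplacian_char_poly_splits[of "adjacency_weight G" ?N]
      adjacency_weight_commute adjacency_weight_nonneg L by metis
  have A: "laplacian G \<in> carrier_mat ?N ?N" by (simp add: L)
  have "[:0, 1:] ^ (length es - k) dvd char_poly (laplacian G)"
    using power_dvd_char_poly_laplacian[OF G] k unfolding len by (elim dvd_trans[rotated]) (intro le_imp_power_dvd diff_le_mono2)
  then have "(\<Sum>j = 1..min k ?N. eigenval j (laplacian G)) = sum_list es"
    using sum_largest_eigenvalues[OF cp nonneg] len by simp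
  also have "\<dots> = 2 * real (card (edges G))"
    using sum_eigenvalues_eq_trace[OF A cp] trace_laplacian[OF G] by simp
  finally show ?thesis by (simp add: laplacian_eps_def)
qed

section \<open>Isomorphism with nearly complete graphs and with stars\<close>

lemma graph_iso_imp_card_eq:
  assumes G: "simple_graph G" and H: "simple_graph H" and iso: "graph_iso G H"
  shows "card (verts G) = card (verts H)" "card (edges G) = card (edges H)"
proof -
  obtain f where f: "bij_betw f (verts G) (verts H)"
    and adj: "\<And>u v. u \<in> verts G \<Longrightarrow> v \<in> verts G \<Longrightarrow> {u, v} \<in> edges G \<longleftrightarrow> {f u, f v} \<in> edges H"
    using iso by (auto simp: graph_iso_def)
  show "card (verts G) = card (verts H)" by (rule bij_betw_same_card[OF f])
  have pair: "\<exists>u\<in>verts K. \<exists>v\<in>verts K. e = {u, v}" if "simple_graph K" "e \<in> edges K"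
    for K :: "'c ugraph" and e
    using that by (auto simp: simple_graph_def nsets_2_eq subset_iff) blast
  have "edges H = (`) f ` edges G"
  proof (intro equalityI subsetI)
    fix e assume e: "e \<in> edges H"
    then obtain x y where "x \<in> verts H" "y \<in> verts H" "e = {x, y}" using pair[OF H] by blast
    moreover have "verts H = f ` verts G" using f by (simp add: bij_betw_def)
    ultimately obtain u v where "u \<in> verts G" "v \<in> verts G" "e = {f u, f v}" by auto
    with adj e have "{u, v} \<in> edges G" "e = f ` {u, v}" by auto
    then show "e \<in> (`) f ` edges G" by blast
  next
    fix e assume "e \<in> (`) f ` edges G"
    then obtain d where d: "d \<in> edges G" "e = f ` d" by auto
    then obtain u v where "u \<in> verts G" "v \<in> verts G" "d = {u, v}" using pair[OF G] by blast
    with d adj show "e \<in> edges H" by auto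
  qed
  moreover have "inj_on ((`) f) (edges G)"
    using inj_on_image_Pow[of f "verts G"] f simple_graph_edge_subset[OF G]
    by (auto simp: bij_betw_def intro: inj_on_subset)
  ultimately show "card (edges G) = card (edges H)" by (simp add: card_image)
qed

lemma card_edges_le_choose_two:
  assumes "simple_graph G"
  shows "card (edges G) \<le> card (verts G) choose 2"
proof -
  have "card (edges G) \<le> card (nsets (verts G) 2)"
    using assms by (intro card_mono finite_imp_finite_nsets) (auto simp: simple_graph_def)
  then show ?thesis by simp
qed

text \<open>
  Any bijection of the vertex set onto \<open>{..<m}\<close> is an isomorphism onto the complete graph minus the
  images of the non-edges. Being of the form \<open>K\<^sub>m - F\<close> with a condition on \<open>|F|\<close> is therefore a condition
  on the numbers of vertices and edges only.
\<close>
lemma graph_iso_complete_graph_minus_iff: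
  assumes G: "simple_graph G"
  shows "(\<exists>F. F \<subseteq> edges (complete_graph m) \<and> P (card F) \<and>
            graph_iso G (delete_edges (complete_graph m) F))
    \<longleftrightarrow> card (verts G) = m \<and> P ((m choose 2) - card (edges G))"
proof -
  let ?K = "nsets {..<m} 2"
  have card_F: "card (verts G) = m \<and> card F = (m choose 2) - card (edges G)"
    if F: "F \<subseteq> ?K" and iso: "graph_iso G ({..<m}, ?K - F)" for F
  proof -
    have "simple_graph ({..<m}, ?K - F)" by (auto simp: simple_graph_def)
    from graph_iso_imp_card_eq[OF G this iso]
    have "card (verts G) = m" "card (edges G) = card (?K - F)" by auto
    moreover have fin: "finite ?K" by (simp add: finite_imp_finite_nsets)
    moreover have "card (?K - F) = (m choose 2) - card F"
      using F finite_subset[OF F fin] by (simp add: card_Diff_subset)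
    moreover have "card F \<le> m choose 2"
      using card_mono[OF fin F] by simp
    ultimately show ?thesis by simp
  qed
  have ex: "\<exists>F \<subseteq> ?K. graph_iso G ({..<m}, ?K - F)" if m: "card (verts G) = m"
  proof -
    obtain f where f: "bij_betw f (verts G) {..<m}"
      using ex_bij_betw_finite_nat[of "verts G"] G m
      by (auto simp: simple_graph_def atLeast0LessThan)
    define F where "F = ?K - (`) f ` edges G"
    have "{u, v} \<in> edges G \<longleftrightarrow> {f u, f v} \<in> ?K - F" if uv: "u \<in> verts G" "v \<in> verts G" for u v
    proof
      assume e: "{u, v} \<in> edges G"
      then have "f u \<noteq> f v"
        using simple_graph_edge_neq[OF G e] f uv by (auto simp: bij_betw_def inj_on_def)
      moreover have "f u < m" "f v < m" using f uv by (auto simp: bij_betw_def)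
      moreover have "{f u, f v} \<in> (`) f ` edges G" using imageI[OF e, of "(`) f"] by simp
      ultimately show "{f u, f v} \<in> ?K - F" by (simp add: F_def)
    next
      assume "{f u, f v} \<in> ?K - F"
      then obtain e where e: "e \<in> edges G" "f ` {u, v} = f ` e" by (auto simp: F_def)
      then have "{u, v} = e"
        using inj_on_image_eq_iff[of f "verts G" "{u, v}" e] f uv simple_graph_edge_subset[OF G]
        by (auto simp: bij_betw_def)
      then show "{u, v} \<in> edges G" using e by simp
    qed
    then have "graph_iso G ({..<m}, ?K - F)" using f by (auto simp: graph_iso_def)
    then show ?thesis by (auto simp: F_def)
  qed
  show ?thesis
    unfolding complete_graph_def delete_edges_def fst_conv snd_conv
    using card_F ex by metis
qed

lemma graph_iso_complete_graph_iff:
  assumes G: "simple_graph G"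
  shows "graph_iso G (complete_graph m) \<longleftrightarrow> card (verts G) = m \<and> card (edges G) = m choose 2"
proof -
  have fin: "finite (edges (complete_graph m))"
    by (simp add: complete_graph_def finite_imp_finite_nsets)
  have "graph_iso G (complete_graph m) \<longleftrightarrow>
      (\<exists>F. F \<subseteq> edges (complete_graph m) \<and> card F = 0 \<and> graph_iso G (delete_edges (complete_graph m) F))"
    using finite_subset[OF _ fin] by (auto simp: delete_edges_def)
  also have "\<dots> \<longleftrightarrow> card (verts G) = m \<and> card (edges G) = m choose 2"
    using graph_iso_complete_graph_minus_iff[OF G, of m "\<lambda>c. c = 0"]
      card_edges_le_choose_two[OF G] by (metis diff_is_0_eq diff_self_eq_0 le_antisym)
  finally show ?thesis .
qed

definition is_star :: "'a ugraph \<Rightarrow> bool" where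
  "is_star G \<longleftrightarrow> (\<exists>a\<in>verts G. edges G = (\<lambda>w. {a, w}) ` (verts G - {a}))"

lemma star_graph_adjacent:
  "{x, y} \<in> edges (star_graph t) \<longleftrightarrow> x \<le> t \<and> y \<le> t \<and> x \<noteq> y \<and> (x = 0 \<or> y = 0)"
  by (auto simp: star_graph_def doubleton_eq_iff)

lemma graph_iso_star_graph_iff:
  assumes G: "simple_graph G"
  shows "graph_iso G (star_graph t) \<longleftrightarrow> card (verts G) = t + 1 \<and> is_star G"
proof
  assume "graph_iso G (star_graph t)"
  then obtain f where f: "bij_betw f (verts G) {0..t}"
    and adj: "\<And>u v. u \<in> verts G \<Longrightarrow> v \<in> verts G \<Longrightarrow>
      {u, v} \<in> edges G \<longleftrightarrow> {f u, f v} \<in> edges (star_graph t)"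
    by (auto simp: graph_iso_def star_graph_def)
  have "0 \<in> f ` verts G" using f by (simp add: bij_betw_def)
  then obtain a where a: "a \<in> verts G" "f a = 0" by auto
  have zero: "u = a" if "u \<in> verts G" "f u = 0" for u
    using f a that by (auto simp: bij_betw_def inj_on_def)
  have le: "f u \<le> t" if "u \<in> verts G" for u
    using f that by (auto simp: bij_betw_def)
  have "edges G = (\<lambda>w. {a, w}) ` (verts G - {a})"
  proof (intro equalityI subsetI)
    fix e assume e: "e \<in> edges G"
    then have "e \<in> nsets (verts G) 2" using G by (auto simp: simple_graph_def)
    then obtain x y where xy: "e = {x, y}" "x \<in> verts G" "y \<in> verts G" "x \<noteq> y"
      by (auto simp: nsets_2_eq)
    have "{f x, f y} \<in> edges (star_graph t)" using adj e xy by simp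
    then have "x = a \<or> y = a" using xy zero by (auto simp: star_graph_adjacent)
    with xy show "e \<in> (\<lambda>w. {a, w}) ` (verts G - {a})" by (auto simp: insert_commute)
  next
    fix e assume "e \<in> (\<lambda>w. {a, w}) ` (verts G - {a})"
    then obtain w where "w \<in> verts G" "w \<noteq> a" "e = {a, w}" by auto
    moreover from this have "{f a, f w} \<in> edges (star_graph t)"
      using a zero[of w] le[of w] unfolding star_graph_adjacent by auto
    ultimately show "e \<in> edges G" using adj a by simp
  qed
  with a have "is_star G" by (auto simp: is_star_def)
  then show "card (verts G) = t + 1 \<and> is_star G" using bij_betw_same_card[OF f] by simp
next
  assume "card (verts G) = t + 1 \<and> is_star G"
  then obtain a where card: "card (verts G) = t + 1" and a: "a \<in> verts G"
    and E: "edges G = (\<lambda>w. {a, w}) ` (verts G - {a})" by (auto simp: is_star_def)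
  have fin: "finite (verts G)" using G by (simp add: simple_graph_def)
  have "card (verts G - {a}) = card {1..t}" using card a fin by simp
  then obtain g where g: "bij_betw g (verts G - {a}) {1..t}"
    using finite_same_card_bij[of "verts G - {a}" "{1..t}"] fin by auto
  define f where "f x = (if x = a then 0 else g x)" for x
  have "bij_betw f (verts G - {a}) {1..t}"
    using g by (subst bij_betw_cong[of _ f g]) (auto simp: f_def)
  then have "bij_betw f ((verts G - {a}) \<union> {a}) ({1..t} \<union> {0})"
    by (intro bij_betw_combine) (auto simp: f_def bij_betw_def)
  moreover have "(verts G - {a}) \<union> {a} = verts G" "{1..t} \<union> {0} = {0..t}" using a by auto
  ultimately have f: "bij_betw f (verts G) {0..t}" by simp
  have zero: "f u = 0 \<longleftrightarrow> u = a" if "u \<in> verts G" for u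
    using bij_betwE[OF g] that by (force simp: f_def)
  have le: "f u \<le> t" if "u \<in> verts G" for u
    using f that by (auto simp: bij_betw_def)
  have eq: "f u = f v \<longleftrightarrow> u = v" if "u \<in> verts G" "v \<in> verts G" for u v
    using f that by (auto simp: bij_betw_def inj_on_def)
  have "{u, v} \<in> edges G \<longleftrightarrow> {f u, f v} \<in> edges (star_graph t)"
    if "u \<in> verts G" "v \<in> verts G" for u v
    using that unfolding star_graph_adjacent E
    by (auto simp: zero le eq doubleton_eq_iff)
  then show "graph_iso G (star_graph t)"
    unfolding graph_iso_def using f by (auto simp: star_graph_def)
qed

section \<open>Removing isolated vertices\<close>

lemma edges_positive_part:
  assumes G: "simple_graph G"
  shows "edges (positive_part G) = edges G"
proof -
  have "0 < vdegree G v" if "e \<in> edges G" "v \<in> e" for e v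
    using that simple_graph_finite_edges[OF G] by (auto simp: vdegree_def card_gt_0_iff)
  then show ?thesis
    using simple_graph_edge_subset[OF G]
    by (auto simp: positive_part_def induced_subgraph_def)
qed

lemma verts_positive_part: "verts (positive_part G) = {v \<in> verts G. 0 < vdegree G v}"
  by (simp add: positive_part_def induced_subgraph_def)

lemma simple_graph_positive_part:
  assumes G: "simple_graph G"
  shows "simple_graph (positive_part G)"
proof -
  have "e \<in> nsets (verts (positive_part G)) 2" if e: "e \<in> edges (positive_part G)" for e
  proof -
    have "e \<subseteq> verts (positive_part G)"
      using e by (auto simp: positive_part_def induced_subgraph_def)
    moreover have "e \<in> nsets (verts G) 2"
      using e G edges_positive_part[OF G] by (auto simp: simple_graph_def)
    ultimately show ?thesis by (auto simp: nsets_def)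
  qed
  moreover have "finite (verts (positive_part G))"
    using G by (simp add: simple_graph_def verts_positive_part)
  ultimately show ?thesis by (auto simp: simple_graph_def)
qed

lemma positive_part_no_isolated:
  assumes G: "simple_graph G" and v: "v \<in> verts (positive_part G)"
  shows "\<exists>e\<in>edges (positive_part G). v \<in> e"
proof -
  have "card {e \<in> edges G. v \<in> e} \<noteq> 0"
    using v by (simp add: verts_positive_part vdegree_def)
  then have "{e \<in> edges G. v \<in> e} \<noteq> {}" by (metis card.empty)
  then show ?thesis by (auto simp: edges_positive_part[OF G])
qed

lemma matching_number_positive_part:
  assumes "simple_graph G"
  shows "matching_number (positive_part G) = matching_number G"
  by (simp add: matching_number_def matching_def edges_positive_part[OF assms])

section \<open>Comparing the number of edges with multiples of the matching number\<close>

lemma obtain_maximum_matching: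
  assumes G: "simple_graph G"
  obtains M where "maximum_matching (verts G) (edges G) M" "card M = matching_number G"
proof -
  have "{M. matching G M} \<subseteq> Pow (edges G)" by (auto simp: matching_def)
  then have fin: "finite {M. matching G M}"
    by (rule finite_subset) (simp add: simple_graph_finite_edges[OF G])
  have "matching G {}" by (simp add: matching_def)
  then have "matching_number G \<in> card ` {M. matching G M}"
    unfolding matching_number_def using fin by (intro Max_in) auto
  then obtain M where M: "matching G M" "card M = matching_number G" by auto
  have "card M' \<le> card M" if "matching G M'" for M'
    unfolding M(2) matching_number_def using fin that by (intro Max_ge) auto
  then have "maximum_matching (verts G) (edges G) M"
    using G M(1) by (auto simp: maximum_matching_def simple_graph_def matching_def)
  then show thesis using M(2) by (rule that)
qed

lemma is_star_card_edges:
  assumes G: "simple_graph G" and star: "is_star G"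
  shows "card (edges G) = card (verts G) - 1"
proof -
  obtain a where a: "a \<in> verts G" "edges G = (\<lambda>w. {a, w}) ` (verts G - {a})"
    using star by (auto simp: is_star_def)
  have "inj_on (\<lambda>w. {a, w}) (verts G - {a})" by (auto simp: inj_on_def doubleton_eq_iff)
  then show ?thesis using a G by (simp add: card_image simple_graph_def)
qed

lemma is_star_matching_number_le:
  assumes G: "simple_graph G" and star: "is_star G"
  shows "matching_number G \<le> 1"
proof -
  obtain a where a: "edges G = (\<lambda>w. {a, w}) ` (verts G - {a})"
    using star by (auto simp: is_star_def)
  obtain M where M: "maximum_matching (verts G) (edges G) M" "card M = matching_number G"
    using obtain_maximum_matching[OF G] .
  then interpret maximum_matching "verts G" "edges G" M by simp
  have "\<not> disjnt e f" if "e \<in> M" "f \<in> M" for e f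
    using that M_edges by (auto simp: a disjnt_def)
  then have "e = f" if "e \<in> M" "f \<in> M" for e f
    using that pairwiseD[OF M_disjnt] by blast
  then have "card M \<le> Suc 0" by (subst card_le_Suc0_iff_eq[OF finite_M]) blast
  then show ?thesis using M(2) by simp
qed

text \<open>
  The extremal argument for stars needs two unmatched vertices. This covers the two graphs with
  \<open>\<nu> = 1\<close> and \<open>|E| = (n - 1) \<nu>\<close> that have fewer: the paths on two and three vertices.
\<close>
lemma small_tree_is_star:
  assumes G: "simple_graph G" and n: "card (verts G) = 2 \<or> card (verts G) = 3"
    and e: "card (edges G) = card (verts G) - 1"
  shows "is_star G"
  using n
proof
  assume n2: "card (verts G) = 2"
  then obtain a b where ab: "verts G = {a, b}" "a \<noteq> b" by (auto simp: card_2_iff)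
  have "edges G \<subseteq> {{a, b}}" using G ab by (simp add: simple_graph_def)
  with e n2 have "edges G = {{a, b}}" by (auto simp: subset_singleton_iff)
  with ab show ?thesis unfolding is_star_def by (intro bexI[of _ a]) auto
next
  assume n3: "card (verts G) = 3"
  let ?K = "nsets (verts G) 2"
  have fin: "finite ?K" and sub: "edges G \<subseteq> ?K"
    using G by (auto simp: simple_graph_def finite_imp_finite_nsets)
  have "card (?K - edges G) = 1"
    using e n3 card_Diff_subset[OF finite_subset[OF sub fin] sub] by (simp add: choose_two)
  then obtain d where d: "?K - edges G = {d}" by (auto simp: card_1_singleton_iff)
  then have "d \<in> ?K" by auto
  then obtain x y where xy: "d = {x, y}" "x \<in> verts G" "y \<in> verts G" "x \<noteq> y"
    by (auto simp: nsets_2_eq)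
  have "card (verts G - {x, y}) = 1" using n3 xy by (simp add: card_Diff_subset)
  then obtain a where "verts G - {x, y} = {a}" by (auto simp: card_1_singleton_iff)
  then have V: "verts G = {a, x, y}" "a \<noteq> x" "a \<noteq> y" using xy by auto
  have "?K = {{a, x}, {a, y}, {x, y}}"
    unfolding V(1) using V(2,3) xy(4) by (auto simp: nsets_2_eq)
  moreover have "edges G = ?K - {d}" using d sub by auto
  ultimately have "edges G = {{a, x}, {a, y}}"
    using V xy by (auto simp: doubleton_eq_iff)
  then show ?thesis
    unfolding is_star_def using V xy by (intro bexI[of _ a]) auto
qed

text \<open>
  From here on the graph enters only through \<open>n\<close>, \<open>\<nu>\<close> and \<open>m\<close>, apart from the question whether it
  is a star.
\<close>
locale edge_matching_counts =
  fixes G :: "'a ugraph" and n \<nu> m :: nat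
  assumes simple: "simple_graph G"
    and no_isolated: "\<And>v. v \<in> verts G \<Longrightarrow> \<exists>e\<in>edges G. v \<in> e"
    and nonempty: "verts G \<noteq> {}"
    and n_def: "n = card (verts G)"
    and nu_def: "\<nu> = matching_number G"
    and m_def: "m = card (edges G)"
begin

lemma matching_bounds:
  shows "2 * \<nu> \<le> n" and "1 \<le> \<nu>"
    and "2 * \<nu> + 2 \<le> n \<Longrightarrow> m \<le> \<nu> * (n - 1)"
    and "2 * \<nu> + 2 \<le> n \<Longrightarrow> m = \<nu> * (n - 1) \<Longrightarrow> is_star G"
proof -
  obtain M where M: "maximum_matching (verts G) (edges G) M" "card M = matching_number G"
    using obtain_maximum_matching[OF simple] .
  then interpret maximum_matching "verts G" "edges G" M by simp
  have cM: "card M = \<nu>" using M(2) nu_def by simp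
  have cV: "n = 2 * \<nu> + card U" using card_V by (simp add: n_def cM)
  then show "2 * \<nu> \<le> n" by simp
  obtain e where e: "e \<in> edges G" using nonempty no_isolated by blast
  have "card {e} \<le> card M" by (rule M_maximum) (use e in simp_all)
  then show nu: "1 \<le> \<nu>" by (simp add: cM)
  assume "2 * \<nu> + 2 \<le> n"
  then have U: "2 \<le> card U" using cV by simp
  show "m \<le> \<nu> * (n - 1)" using card_edges_le[OF U] by (simp add: cM m_def n_def)
  assume "m = \<nu> * (n - 1)"
  then show "is_star G"
    using extremal_imp_star[OF U _ no_isolated] nu by (simp add: cM m_def n_def is_star_def)
qed

lemma le_choose_two: "m \<le> n * (n - 1) div 2"
  using card_edges_le_choose_two[OF simple] by (simp add: m_def n_def choose_two)

lemma size_cases: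
  obtains (even) "n = 2 * \<nu>" "m \<le> \<nu> * (n - 1)"
  | (odd) "n = 2 * \<nu> + 1" "m \<le> \<nu> * (2 * \<nu> + 1)"
  | (large) "2 * \<nu> + 2 \<le> n" "m \<le> \<nu> * (n - 1)"
proof -
  consider "n = 2 * \<nu>" | "n = 2 * \<nu> + 1" | "2 * \<nu> + 2 \<le> n"
    using matching_bounds(1) by linarith
  then show thesis
  proof cases
    case 1
    then show thesis using even le_choose_two by simp
  next
    case 2
    then have "n * (n - 1) div 2 = \<nu> * (2 * \<nu> + 1)" by simp
    then show thesis using odd 2 le_choose_two by simp
  next
    case 3
    then show thesis using large matching_bounds(3) by simp
  qed
qed

text \<open>
  A smaller matching number would put the graph into the case \<open>n \<ge> 2 \<nu> + 2\<close>, where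
  \<open>m \<le> \<nu> (n - 1) \<le> 2 r\<^sup>2\<close>. In this way the matching number of a nearly complete graph is found
  without exhibiting a matching.
\<close>
lemma dense_odd_matching_number:
  assumes n: "n = 2 * r + 1" and m: "2 * r * r < m"
  shows "\<nu> = r"
proof -
  have "\<nu> \<le> r" using matching_bounds(1) n by simp
  then have "\<nu> * (n - 1) \<le> 2 * r * r" using n by simp
  with m n show ?thesis by (cases rule: size_cases) auto
qed

text \<open>
  On \<open>n = 2 r + 1\<close> vertices, the natural number \<open>r (2 r + 1) - m\<close> counts the missing edges.
\<close>
lemma exceeds_iff:
  "\<nu> * (n - 1) < m \<longleftrightarrow> (\<exists>r\<ge>1. n = 2 * r + 1 \<and> r * (2 * r + 1) - m < r)"
proof
  assume "\<nu> * (n - 1) < m"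
  then show "\<exists>r\<ge>1. n = 2 * r + 1 \<and> r * (2 * r + 1) - m < r"
    using matching_bounds(2)
    by (cases rule: size_cases) (auto simp: algebra_simps intro!: exI[of _ \<nu>])
next
  assume "\<exists>r\<ge>1. n = 2 * r + 1 \<and> r * (2 * r + 1) - m < r"
  then obtain r where r: "1 \<le> r" "n = 2 * r + 1" "2 * r * r < m"
    by (auto simp: algebra_simps)
  with dense_odd_matching_number show "\<nu> * (n - 1) < m" by (simp add: algebra_simps)
qed

lemma equality_n_iff: "m = n * \<nu> \<longleftrightarrow> (\<exists>r\<ge>1. n = 2 * r + 1 \<and> m = r * (2 * r + 1))"
proof
  assume eq: "m = n * \<nu>"
  have "\<nu> * (n - 1) < n * \<nu>" using matching_bounds(1,2) by (cases n) auto
  with eq show "\<exists>r\<ge>1. n = 2 * r + 1 \<and> m = r * (2 * r + 1)"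
    using matching_bounds(2) by (cases rule: size_cases) (auto simp: mult.commute)
next
  assume "\<exists>r\<ge>1. n = 2 * r + 1 \<and> m = r * (2 * r + 1)"
  then obtain r where r: "1 \<le> r" "n = 2 * r + 1" "m = r * (2 * r + 1)" by auto
  then have "\<nu> = r" by (intro dense_odd_matching_number) (auto simp: algebra_simps)
  with r show "m = n * \<nu>" by simp
qed

lemma le_n_times: "m \<le> n * \<nu>"
  by (cases rule: size_cases) (auto simp: algebra_simps intro: le_trans)

text \<open>
  If \<open>n \<ge> 2 \<nu> + 2\<close>, equality makes the graph a star; otherwise it determines \<open>m\<close> in terms of
  \<open>n\<close>. For \<open>\<nu> = 1\<close> the graphs
  \<open>K\<^sub>2\<close> and \<open>K\<^sub>3\<close> minus an edge are stars, which is why the other two families start at \<open>r = 2\<close>.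
  Conversely, the numbers of vertices and edges force \<open>\<nu> = r\<close>, as a smaller \<open>\<nu>\<close> would leave
  room for fewer than \<open>m\<close> edges.
\<close>
lemma equality_pred_iff:
  "m = (n - 1) * \<nu> \<longleftrightarrow>
     is_star G \<or> (\<exists>r\<ge>2. n = 2 * r \<and> m = r * (2 * r - 1)) \<or>
     (\<exists>r\<ge>2. n = 2 * r + 1 \<and> r * (2 * r + 1) - m = r)"
  (is "_ \<longleftrightarrow> ?star \<or> ?even \<or> ?odd")
proof
  assume eq: "m = (n - 1) * \<nu>"
  show "?star \<or> ?even \<or> ?odd"
  proof (cases rule: size_cases)
    case even
    show ?thesis
    proof (cases "\<nu> = 1")
      case True
      then show ?thesis using small_tree_is_star[OF simple] even eq by (simp add: n_def m_def)
    next
      case False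
      then have "2 \<le> \<nu>" using matching_bounds(2) by simp
      with even eq show ?thesis by (auto simp: mult.commute)
    qed
  next
    case odd
    show ?thesis
    proof (cases "\<nu> = 1")
      case True
      then show ?thesis using small_tree_is_star[OF simple] odd eq by (simp add: n_def m_def)
    next
      case False
      then have "2 \<le> \<nu>" using matching_bounds(2) by simp
      with odd eq have ?odd by (intro exI[of _ \<nu>]) (simp add: algebra_simps)
      then show ?thesis by simp
    qed
  next
    case large
    then show ?thesis using matching_bounds(4) eq by (simp add: mult.commute)
  qed
next
  assume "?star \<or> ?even \<or> ?odd"
  then consider ?star | r where "2 \<le> r" "n = 2 * r" "m = r * (2 * r - 1)"
    | r where "2 \<le> r" "n = 2 * r + 1" "r * (2 * r + 1) - m = r" by blast
  then show "m = (n - 1) * \<nu>"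
  proof cases
    case 1
    then have "\<nu> = 1"
      using is_star_matching_number_le[OF simple] matching_bounds(2) nu_def by simp
    then show ?thesis using is_star_card_edges[OF simple 1] by (simp add: n_def m_def)
  next
    case (2 r)
    have "\<nu> = r"
    proof (cases rule: size_cases)
      case large
      then have "r * (2 * r - 1) \<le> \<nu> * (2 * r - 1)" using 2 by simp
      then have "r \<le> \<nu>" using 2 by simp
      with large 2 show ?thesis by simp
    qed (use 2 in auto)
    with 2 show ?thesis by (simp add: mult.commute)
  next
    case (3 r)
    then have m: "m = 2 * r * r" by (simp add: algebra_simps)
    have "\<nu> = r"
    proof (cases rule: size_cases)
      case large
      then have "r * (2 * r) \<le> \<nu> * (2 * r)" using 3 m by (simp add: mult.commute)
      then have "r \<le> \<nu>" using 3 by simp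
      with large 3 show ?thesis by simp
    qed (use 3 in auto)
    with 3 m show ?thesis by simp
  qed
qed

end

section \<open>The theorem\<close>

lemma choose_two_odd: "(2 * r + 1) choose 2 = r * (2 * r + 1)"
  by (simp add: choose_two)

lemma choose_two_even: "(2 * r) choose 2 = r * (2 * r - 1)"
  by (simp add: choose_two)

theorem theorem1p3:
  fixes G :: "'a ugraph" and n \<nu> k :: nat
  assumes "simple_graph G"
    and "n = card (verts (positive_part G))"
    and "\<nu> = matching_number G"
    and "int k \<ge> int n - 1"
  shows
    "(laplacian_eps k G \<le> real k * real \<nu> \<longleftrightarrow>
        \<not> (int k = int n - 1 \<and>
           (\<exists>r F. r \<ge> 1 \<and> F \<subseteq> edges (complete_graph (2 * r + 1)) \<and> card F < r \<and>
                  graph_iso (positive_part G) (delete_edges (complete_graph (2 * r + 1)) F))))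
     \<and> (n \<ge> 1 \<and> k \<ge> n \<longrightarrow>
        (laplacian_eps k G = real k * real \<nu> \<longleftrightarrow>
           k = n \<and> (\<exists>r\<ge>1. graph_iso (positive_part G) (complete_graph (2 * r + 1)))))
     \<and> (int k = int n - 1 \<longrightarrow>
        (laplacian_eps k G = real k * real \<nu> \<longleftrightarrow>
           (\<exists>t\<ge>1. graph_iso (positive_part G) (star_graph t)) \<or>
           (\<exists>r\<ge>2. graph_iso (positive_part G) (complete_graph (2 * r))) \<or>
           (\<exists>r F. r \<ge> 2 \<and> F \<subseteq> edges (complete_graph (2 * r + 1)) \<and> card F = r \<and>
                  graph_iso (positive_part G) (delete_edges (complete_graph (2 * r + 1)) F))))"
proof -
  let ?H = "positive_part G"
  define m where "m = card (edges ?H)"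
  note H = simple_graph_positive_part[OF assms(1)]
  have "card {v \<in> verts G. 0 < vdegree G v} - 1 \<le> k"
    using assms(2,4) by (simp add: verts_positive_part)
  then have eps: "laplacian_eps k G = real m"
    using laplacian_eps_eq_card_edges[OF assms(1)]
    by (simp add: m_def edges_positive_part[OF assms(1)])
  have le_iff: "laplacian_eps k G \<le> real k * real \<nu> \<longleftrightarrow> m \<le> k * \<nu>"
    and eq_iff: "laplacian_eps k G = real k * real \<nu> \<longleftrightarrow> m = k * \<nu>"
    unfolding eps of_nat_mult[symmetric] by (rule of_nat_le_iff, rule of_nat_eq_iff)
  have minus: "(\<exists>r F. Q r \<and> F \<subseteq> edges (complete_graph (2 * r + 1)) \<and> P r (card F) \<and>
        graph_iso ?H (delete_edges (complete_graph (2 * r + 1)) F)) \<longleftrightarrow>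
      (\<exists>r. Q r \<and> n = 2 * r + 1 \<and> P r (r * (2 * r + 1) - m))" for P Q
    using graph_iso_complete_graph_minus_iff[OF H, of "2 * r + 1" "P r" for r]
    unfolding choose_two_odd m_def[symmetric] assms(2)[symmetric] by blast
  have complete: "graph_iso ?H (complete_graph c) \<longleftrightarrow> n = c \<and> m = c choose 2" for c
    using graph_iso_complete_graph_iff[OF H] by (simp add: m_def assms(2))
  show ?thesis
  proof (cases "n = 0")
    case True
    \<comment> \<open>Without edges both sides of the inequality vanish, and no natural number \<open>k\<close> equals the integer \<open>n - 1\<close>.\<close>
    have "verts ?H = {}" using True assms(2) H by (simp add: simple_graph_def)
    then have "edges ?H = {}" using H by (simp add: simple_graph_def nsets_empty_iff)
    then show ?thesis unfolding le_iff using True by (simp add: m_def)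
  next
    case False
    interpret edge_matching_counts ?H n \<nu> m
    proof
      show "verts ?H \<noteq> {}" using False assms(2) by auto
      show "\<nu> = matching_number ?H"
        using assms(1,3) by (simp add: matching_number_positive_part)
    qed (use H assms(1,2) positive_part_no_isolated[OF assms(1)] in \<open>auto simp: m_def\<close>)
    have n2: "2 \<le> n" using matching_bounds(1,2) by simp
    have pred: "int k = int n - 1 \<longleftrightarrow> k = n - 1" and k: "n - 1 \<le> k"
      using False assms(4) by auto
    have mono: "n * \<nu> \<le> k * \<nu>" if "n \<le> k" using that by simp
    have star: "(\<exists>t\<ge>1. graph_iso ?H (star_graph t)) \<longleftrightarrow> is_star ?H"
    proof
      assume "is_star ?H"
      then have "graph_iso ?H (star_graph (n - 1))"
        using n2 graph_iso_star_graph_iff[OF H, of "n - 1"] assms(2) by simp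
      with n2 show "\<exists>t\<ge>1. graph_iso ?H (star_graph t)" by (intro exI[of _ "n - 1"]) simp
    qed (use graph_iso_star_graph_iff[OF H] in blast)
    have le: "m \<le> k * \<nu> \<longleftrightarrow> \<not> (k = n - 1 \<and> (\<exists>r. 1 \<le> r \<and> n = 2 * r + 1 \<and> r * (2 * r + 1) - m < r))"
    proof (cases "k = n - 1")
      case True
      have "m \<le> k * \<nu> \<longleftrightarrow> \<not> \<nu> * (n - 1) < m" using True by (simp add: mult.commute not_less)
      with True show ?thesis unfolding exceeds_iff by simp
    next
      case False
      then have "n \<le> k" using k by simp
      then show ?thesis using le_trans[OF le_n_times mono] False by simp
    qed
    have eq_large: "m = k * \<nu> \<longleftrightarrow> k = n \<and> (\<exists>r\<ge>1. n = 2 * r + 1 \<and> m = r * (2 * r + 1))"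
      if "n \<le> k"
    proof (cases "k = n")
      case True
      then show ?thesis using equality_n_iff by simp
    next
      case False
      then have "n * \<nu> < k * \<nu>" using that matching_bounds(2) by simp
      then have "m < k * \<nu>" using le_n_times by (rule le_less_trans[rotated])
      then show ?thesis using False by simp
    qed
    show ?thesis
      unfolding le_iff eq_iff pred complete choose_two_odd choose_two_even star
        minus[where Q = "\<lambda>r. 1 \<le> r" and P = "\<lambda>r c. c < r"]
        minus[where Q = "\<lambda>r. 2 \<le> r" and P = "\<lambda>r c. c = r"]
    proof (intro conjI impI)
      assume "1 \<le> n \<and> n \<le> k"
      then show "m = k * \<nu> \<longleftrightarrow> k = n \<and> (\<exists>r\<ge>1. n = 2 * r + 1 \<and> m = r * (2 * r + 1))"
        by (intro eq_large) simp
    next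
      assume "k = n - 1"
      then show "m = k * \<nu> \<longleftrightarrow> is_star ?H \<or> (\<exists>r\<ge>2. n = 2 * r \<and> m = r * (2 * r - 1)) \<or>
          (\<exists>r. 2 \<le> r \<and> n = 2 * r + 1 \<and> r * (2 * r + 1) - m = r)"
        using equality_pred_iff by simp
    qed (rule le)
  qed
qed

end
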